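(* Every Banach space $X$ with property $\mathcal{E}'$ has weak*-convex block compact dual ball.
   Context: $B_{X^*}$ denotes the closed unit ball of the dual $X^*$. A set $C\subseteq B_{X^*}$ is weak*-sequentially closed if it coincides with the set of all limits of weak*-convergent sequences of elements of $C$. A Banach space $X$ has property $\mathcal{E}'$ if every weak*-sequentially closed convex set $C\subseteq B_{X^*}$ is weak*-closed. If $(x_n)_{n\in\mathbb{N}}$ is a sequence in a Banach space, then $(y_k)_{k\in\mathbb{N}}$ is a convex block subsequence of $(x_n)_{n\in\mathbb{N}}$ if there are a sequence $(I_k)_{k\in\mathbb{N}}$ of finite subsets of $\mathbb{N}$ with $\max(I_k)<\min(I_{k+1})$ for every $k$ and a sequence $a_n\in[0,1]$ with $\sum_{n\in I_k}a_n=1$ for every $k\in\mathbb{N}$ such that $y_k=\sum_{n\in I_k}a_nx_n$ for every $k\in\mathbb{N}$. A Banach space $X$ has weak*-convex block compact dual ball if every bounded sequence in $X^*$ has a weak*-convergent convex block subsequence. *)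

theory Defs
  imports "HOL-Analysis.Analysis"
begin

text \<open>The dual of a Banach space is the type of bounded linear maps into the reals,
  with the operator norm. For functionals, the strong operator topology is the topology of
  pointwise convergence on the space, i.e. the weak* topology.\<close>

type_synonym 'a dual = "'a \<Rightarrow>\<^sub>L real"

abbreviation weak_star_topology :: "('a::banach) dual topology" where
  "weak_star_topology \<equiv> strong_operator_topology"

definition weak_star_seq_closed :: "('a::banach) dual set \<Rightarrow> bool" where
  "weak_star_seq_closed C \<longleftrightarrow>
     C = {f. \<exists>s. (\<forall>n::nat. s n \<in> C) \<and> limitin weak_star_topology s f sequentially}"

definition property_E' :: "('a::banach) itself \<Rightarrow> bool" where
  "property_E' (_ :: 'a itself) \<longleftrightarrow>
     (\<forall>C :: 'a dual set. C \<subseteq> cball 0 1 \<and> convex C \<and> weak_star_seq_closed C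
        \<longrightarrow> closedin weak_star_topology C)"

text \<open>The blocks are required to be nonempty so that \<open>Max\<close> and \<open>Min\<close> are meaningful.\<close>

definition convex_block_subsequence ::
    "(nat \<Rightarrow> 'b::real_vector) \<Rightarrow> (nat \<Rightarrow> 'b) \<Rightarrow> bool" where
  "convex_block_subsequence y x \<longleftrightarrow>
     (\<exists>(I :: nat \<Rightarrow> nat set) (a :: nat \<Rightarrow> real).
        (\<forall>k. finite (I k) \<and> I k \<noteq> {}) \<and>
        (\<forall>k. Max (I k) < Min (I (Suc k))) \<and>
        (\<forall>n. a n \<in> {0..1}) \<and>
        (\<forall>k. (\<Sum>n\<in>I k. a n) = 1) \<and>
        (\<forall>k. y k = (\<Sum>n\<in>I k. a n *\<^sub>R x n)))"

definition weak_star_convex_block_compact_dual_ball :: "('a::banach) itself \<Rightarrow> bool" where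
  "weak_star_convex_block_compact_dual_ball (_ :: 'a itself) \<longleftrightarrow>
     (\<forall>x :: nat \<Rightarrow> 'a dual. bounded (range x) \<longrightarrow>
        (\<exists>y f. convex_block_subsequence y x \<and>
               limitin weak_star_topology y f sequentially))"

end

theory Submission
  imports Defs
begin

text \<open>
  Suppose that a sequence \<open>x\<close> in the dual ball has no weak* convergent convex block subsequence,
  and let \<open>C\<close> be the norm closure of its convex hull. If convex combinations of the \<open>x n\<close> converge
  weak*, then along a subsequence the coefficients converge pointwise, to \<open>a\<close> say. If \<open>a\<close> has
  total mass less than 1, then subtracting the series \<open>\<Sum>n. a n *\<^sub>R x n\<close> and normalising what is left
  gives a weak* convergent convex block subsequence, by a gliding hump; so the mass is 1 and the
  combinations converge in norm. Hence \<open>C\<close> is weak*-sequentially closed, and property \<open>\<E>'\<close> makes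
  it weak* compact. As \<open>C\<close> is norm separable, countably many vectors separate its points. A
  diagonal subsequence of \<open>x\<close> that converges on these vectors has a single weak* cluster point
  and so converges weak*, which is a contradiction.
\<close>

section \<open>Weak* convergence\<close>

text \<open>\<open>strong_operator_topology\<close> is the pullback under
  \<open>blinfun_apply\<close> of the topology on functions, which is the product topology, so
  limits are taken coordinatewise.\<close>

lemma limitin_weak_star_iff:
  "limitin strong_operator_topology s f F \<longleftrightarrow>
    (\<forall>v. ((\<lambda>i. blinfun_apply (s i) v) \<longlongrightarrow> blinfun_apply f v) F)"
proof -
  have "limitin strong_operator_topology s f F \<longleftrightarrow>
      limitin euclidean (\<lambda>i. blinfun_apply (s i)) (blinfun_apply f) F"
    unfolding limitin_def strong_operator_topology_def
    by (auto simp: openin_pullback_topology topspace_pullback_topology)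
  also have "\<dots> \<longleftrightarrow> (\<forall>v. ((\<lambda>i. blinfun_apply (s i) v) \<longlongrightarrow> blinfun_apply f v) F)"
    by (subst euclidean_product_topology[symmetric]) (simp add: limitin_componentwise)
  finally show ?thesis .
qed

lemma tendsto_imp_limitin_weak_star:
  assumes "(s \<longlongrightarrow> f) F"
  shows "limitin strong_operator_topology s f F"
  unfolding limitin_weak_star_iff
  using assms by (auto intro!: tendsto_intros)

text \<open>Tychonoff's theorem, moved from the explicit product topology to the type class topology
  on functions.\<close>

lemma compact_PiE_UNIV:
  fixes S :: "'i \<Rightarrow> 'b::topological_space set"
  assumes "\<And>i. compact (S i)"
  shows "compact (PiE UNIV S)"
  using assms compactin_PiE[of "\<lambda>_. euclidean" UNIV S]
  by (simp add: euclidean_product_topology)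

text \<open>Filters take the place of subnets in this form of the Banach--Alaoglu theorem.\<close>

lemma bounded_imp_weak_star_cluster_point:
  fixes v :: "'i \<Rightarrow> 'a::real_normed_vector \<Rightarrow>\<^sub>L real"
  assumes F: "F \<noteq> bot" and bnd: "\<And>i. norm (v i) \<le> B"
  obtains G p where "G \<le> F" "G \<noteq> bot" "limitin strong_operator_topology v p G"
proof -
  let ?v = "\<lambda>i. blinfun_apply (v i)"
  \<comment> \<open>A product of compact intervals that contains every \<open>v i\<close>.\<close>
  define K where "K = PiE UNIV (\<lambda>u::'a. {- (B * norm u)..B * norm u})"
  have "\<bar>?v i u\<bar> \<le> B * norm u" for i u
    using norm_blinfun[of "v i" u] mult_right_mono[OF bnd[of i], of "norm u"] by auto
  then have vK: "?v i \<in> K" for i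
    by (auto simp: K_def abs_le_iff minus_le_iff)
  have "compact K" unfolding K_def by (intro compact_PiE_UNIV compact_Icc)
  moreover have "filtermap ?v F \<noteq> bot" using F by (simp add: filtermap_bot_iff)
  moreover have "eventually (\<lambda>g. g \<in> K) (filtermap ?v F)"
    using vK by (simp add: eventually_filtermap)
  ultimately obtain g where g: "g \<in> K" "inf (nhds g) (filtermap ?v F) \<noteq> bot"
    unfolding compact_filter by blast
  \<comment> \<open>Compactness gives only a cluster point \<open>g\<close> of the image filter.
    Meeting \<open>F\<close> with the preimages of the neighbourhoods of \<open>g\<close> makes it a
    limit along a finer filter.\<close>
  define G where "G = inf (filtercomap ?v (nhds g)) F"
  have "G \<noteq> bot"
  proof
    assume "G = bot"
    then obtain P Q where PQ: "eventually P (filtercomap ?v (nhds g))" "eventually Q F"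
        "\<And>i. P i \<Longrightarrow> Q i \<Longrightarrow> False"
      unfolding G_def trivial_limit_def eventually_inf by auto
    then obtain R where R: "eventually R (nhds g)" "\<And>i. R (?v i) \<Longrightarrow> P i"
      unfolding eventually_filtercomap by auto
    have "eventually (\<lambda>h. \<not> R h) (filtermap ?v F)"
      unfolding eventually_filtermap by (rule eventually_mono[OF PQ(2)]) (use PQ(3) R(2) in blast)
    with R(1) have "inf (nhds g) (filtermap ?v F) = bot"
      unfolding trivial_limit_def eventually_inf by blast
    with g(2) show False by simp
  qed
  have "filterlim ?v (nhds g) G"
    unfolding G_def by (rule filterlim_mono[OF filterlim_filtercomap order_refl inf_le1])
  then have lim: "((\<lambda>i. ?v i u) \<longlongrightarrow> g u) G" for u
    by (rule continuous_on_tendsto_compose[OF continuous_on_product_coordinates]) auto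
  have "bounded_linear g"
  proof (rule bounded_linear_intro)
    fix u w
    have "((\<lambda>i. ?v i (u + w)) \<longlongrightarrow> g u + g w) G"
      using tendsto_add[OF lim[of u] lim[of w]] by (simp add: blinfun.add_right)
    then show "g (u + w) = g u + g w"
      using lim[of "u + w"] \<open>G \<noteq> bot\<close> tendsto_unique by blast
  next
    fix r u
    have "((\<lambda>i. ?v i (r *\<^sub>R u)) \<longlongrightarrow> r *\<^sub>R g u) G"
      using tendsto_scaleR[OF tendsto_const[of r] lim[of u]] by (simp add: blinfun.scaleR_right)
    then show "g (r *\<^sub>R u) = r *\<^sub>R g u"
      using lim[of "r *\<^sub>R u"] \<open>G \<noteq> bot\<close> tendsto_unique by blast
  next
    fix u
    show "norm (g u) \<le> norm u * B"
      using g(1) by (auto simp: K_def PiE_iff abs_le_iff minus_le_iff mult.commute)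
  qed
  then have "limitin strong_operator_topology v (Blinfun g) G"
    using lim by (simp add: limitin_weak_star_iff bounded_linear_Blinfun_apply)
  moreover have "G \<le> F" by (simp add: G_def)
  ultimately show thesis using that \<open>G \<noteq> bot\<close> by blast
qed

text \<open>A countable product of compact intervals is compact in a first countable space, hence
  sequentially compact; this replaces an explicit diagonal argument.\<close>

lemma pointwise_convergent_subsequence:
  fixes f :: "nat \<Rightarrow> nat \<Rightarrow> real"
  assumes "\<And>n i. \<bar>f n i\<bar> \<le> B i"
  obtains r l where "strict_mono (r::nat \<Rightarrow> nat)" "\<And>i. (\<lambda>n. f (r n) i) \<longlonglongrightarrow> l i"
proof -
  have "seq_compact (PiE UNIV (\<lambda>i. {- B i..B i}))"
    by (intro compact_imp_seq_compact compact_PiE_UNIV compact_Icc)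
  moreover have "f n \<in> PiE UNIV (\<lambda>i. {- B i..B i})" for n
    using assms by (auto simp: abs_le_iff minus_le_iff)
  ultimately obtain l r where "strict_mono (r::nat \<Rightarrow> nat)" "(f \<circ> r) \<longlonglongrightarrow> l"
    unfolding seq_compact_def by metis
  moreover have "(\<lambda>n. f (r n) i) \<longlonglongrightarrow> l i" for i
  proof -
    have "limitin (product_topology (\<lambda>_. euclidean) UNIV) (f \<circ> r) l sequentially"
      using \<open>(f \<circ> r) \<longlonglongrightarrow> l\<close> by (simp add: euclidean_product_topology)
    then show ?thesis by (simp add: limitin_componentwise o_def)
  qed
  ultimately show thesis using that by blast
qed

section \<open>Convex block subsequences\<close>

text \<open>The blocks are consecutive intervals cut at the \<open>N k\<close>, with weights given
  block by block. As the intervals are disjoint, the weights merge into the single sequence that the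
  definition asks for.\<close>

lemma convex_block_subsequenceI:
  fixes x :: "nat \<Rightarrow> 'b::real_vector" and N :: "nat \<Rightarrow> nat"
  assumes N: "strict_mono N"
    and c: "\<And>k n. n \<in> {N k..<N (Suc k)} \<Longrightarrow> 0 \<le> c k n"
    and sum: "\<And>k. (\<Sum>n=N k..<N (Suc k). c k n) = 1"
    and y: "\<And>k. y k = (\<Sum>n=N k..<N (Suc k). c k n *\<^sub>R x n)"
  shows "convex_block_subsequence y x"
proof -
  define I where "I k = {N k..<N (Suc k)}" for k
  \<comment> \<open>Disjointness makes the chosen block unique. The default 0 concerns only the
    indices before \<open>N 0\<close>.\<close>
  define a where "a n = (if \<exists>k. n \<in> I k then c (SOME k. n \<in> I k) n else 0)" for n
  have less: "N k < N (Suc k)" for k using N by (simp add: strict_mono_Suc_iff)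
  have uniq: "k = l" if "n \<in> I k" "n \<in> I l" for k l n
  proof -
    have "N k < N (Suc l)" "N l < N (Suc k)" using that by (auto simp: I_def)
    then show ?thesis using strict_mono_less[OF N] by (meson less_antisym less_SucE not_less_eq)
  qed
  have a: "a n = c k n" if "n \<in> I k" for n k
  proof -
    have "(SOME k. n \<in> I k) = k" using that uniq by (intro some_equality) auto
    then show ?thesis using that by (auto simp: a_def)
  qed
  have fin: "finite (I k)" "I k \<noteq> {}" for k using less[of k] by (auto simp: I_def)
  have "a n \<in> {0..1}" for n
  proof (cases "\<exists>k. n \<in> I k")
    case True
    then obtain k where k: "n \<in> I k" ..
    have "c k n \<le> (\<Sum>n\<in>I k. c k n)"
      using k c fin by (intro member_le_sum) (auto simp: I_def)
    then show ?thesis using a[OF k] c[of n k] k sum[of k] by (auto simp: I_def)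
  qed (simp add: a_def)
  moreover have "Max (I k) < Min (I (Suc k))" for k
  proof -
    have "Max (I k) \<in> I k" "Min (I (Suc k)) \<in> I (Suc k)" using fin by auto
    then show ?thesis by (auto simp: I_def)
  qed
  moreover have "(\<Sum>n\<in>I k. a n) = 1" for k using a sum[of k] by (simp add: I_def)
  moreover have "y k = (\<Sum>n\<in>I k. a n *\<^sub>R x n)" for k using a y[of k] by (simp add: I_def)
  ultimately show ?thesis unfolding convex_block_subsequence_def
    using fin by (intro exI[of _ I] exI[of _ a] conjI allI)
qed

text \<open>All the weight of the block \<open>{r k..<r (Suc k)}\<close> sits on its left
  end.\<close>

lemma subsequence_imp_convex_block_subsequence:
  fixes x :: "nat \<Rightarrow> 'b::real_vector"
  assumes r: "strict_mono r"
  shows "convex_block_subsequence (x \<circ> r) x"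
proof (rule convex_block_subsequenceI[OF r, where c = "\<lambda>k n. if n = r k then 1 else 0"])
  fix k
  have *: "r k \<in> {r k..<r (Suc k)}" using r by (simp add: strict_mono_Suc_iff)
  show "(\<Sum>n = r k..<r (Suc k). if n = r k then 1 else 0 :: real) = 1"
    using * by (simp add: sum.delta)
  have "(\<Sum>n = r k..<r (Suc k). (if n = r k then 1 else 0) *\<^sub>R x n)
      = (\<Sum>n = r k..<r (Suc k). if n = r k then x n else 0)"
    by (intro sum.cong) auto
  then show "(x \<circ> r) k = (\<Sum>n = r k..<r (Suc k). (if n = r k then 1 else 0) *\<^sub>R x n)"
    using * by (simp add: sum.delta)
qed auto

lemma convex_block_subsequence_scaleR:
  assumes "convex_block_subsequence y x"
  shows "convex_block_subsequence (\<lambda>k. c *\<^sub>R y k) (\<lambda>n. c *\<^sub>R x n)"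
proof -
  obtain I a where I: "\<forall>k. finite (I k) \<and> I k \<noteq> {}" "\<forall>k. Max (I k) < Min (I (Suc k))"
      "\<forall>n. a n \<in> {0..1::real}" "\<forall>k. (\<Sum>n\<in>I k. a n) = 1"
    and y: "\<forall>k. y k = (\<Sum>n\<in>I k. a n *\<^sub>R x n)"
    using assms unfolding convex_block_subsequence_def by blast
  have "\<forall>k. c *\<^sub>R y k = (\<Sum>n\<in>I k. a n *\<^sub>R c *\<^sub>R x n)"
    using y by (simp add: scaleR_sum_right mult.commute)
  with I show ?thesis unfolding convex_block_subsequence_def by blast
qed

text \<open>Coefficients are indexed by \<open>n\<close> and not by the vector \<open>x n\<close>, as in \<open>convex hull\<close>, because
  a limit of coefficients is taken below and \<open>x\<close> need not be injective.\<close>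

definition finite_convex_combinations :: "(nat \<Rightarrow> 'b::real_vector) \<Rightarrow> 'b set" where
  "finite_convex_combinations x = {(\<Sum>n<N. c n *\<^sub>R x n) | c N.
     (\<forall>n. 0 \<le> c n) \<and> (\<forall>n\<ge>N. c n = 0) \<and> (\<Sum>n<N. c n) = (1::real)}"

lemma finite_convex_combinationsE:
  assumes "z \<in> finite_convex_combinations x"
  obtains c N where "\<And>n. 0 \<le> c n" "\<And>n. N \<le> n \<Longrightarrow> c n = 0" "(\<Sum>n<N. c n) = 1"
    "z = (\<Sum>n<N. c n *\<^sub>R x n)"
  using assms unfolding finite_convex_combinations_def by blast

lemma element_in_finite_convex_combinations: "x m \<in> finite_convex_combinations x"
proof -
  have "(\<Sum>n<Suc m. (if n = m then 1 else 0) *\<^sub>R x n) = (\<Sum>n<Suc m. if n = m then x n else 0)"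
    by (intro sum.cong) auto
  then have "x m = (\<Sum>n<Suc m. (if n = m then 1 else 0) *\<^sub>R x n)"
    by (simp add: sum.delta)
  then show ?thesis unfolding finite_convex_combinations_def mem_Collect_eq
    by (intro exI[of _ "\<lambda>n. if n = m then 1 else 0"] exI[of _ "Suc m"]) (auto simp: sum.delta)
qed

lemma sum_lessThan_eq_of_support:
  fixes g :: "nat \<Rightarrow> 'b::comm_monoid_add"
  assumes "N \<le> M" "\<And>n. N \<le> n \<Longrightarrow> g n = 0"
  shows "(\<Sum>n<M. g n) = (\<Sum>n<N. g n)"
  using assms by (intro sum.mono_neutral_right) auto

lemma convex_finite_convex_combinations: "convex (finite_convex_combinations x)"
proof (rule convexI)
  fix y z and u w :: real
  assume y: "y \<in> finite_convex_combinations x" and z: "z \<in> finite_convex_combinations x"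
    and uw: "0 \<le> u" "0 \<le> w" "u + w = 1"
  obtain c N where c: "\<And>n. 0 \<le> c n" "\<And>n. N \<le> n \<Longrightarrow> c n = 0" "(\<Sum>n<N. c n) = 1"
    "y = (\<Sum>n<N. c n *\<^sub>R x n)" using y finite_convex_combinationsE by blast
  obtain d M where d: "\<And>n. 0 \<le> d n" "\<And>n. M \<le> n \<Longrightarrow> d n = 0" "(\<Sum>n<M. d n) = 1"
    "z = (\<Sum>n<M. d n *\<^sub>R x n)" using z finite_convex_combinationsE by blast
  define L where "L = max N M"
  define e where "e n = u * c n + w * d n" for n
  have c': "(\<Sum>n<L. c n) = 1" "y = (\<Sum>n<L. c n *\<^sub>R x n)"
    using c sum_lessThan_eq_of_support[of N L c]
      sum_lessThan_eq_of_support[of N L "\<lambda>n. c n *\<^sub>R x n"] by (auto simp: L_def)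
  have d': "(\<Sum>n<L. d n) = 1" "z = (\<Sum>n<L. d n *\<^sub>R x n)"
    using d sum_lessThan_eq_of_support[of M L d]
      sum_lessThan_eq_of_support[of M L "\<lambda>n. d n *\<^sub>R x n"] by (auto simp: L_def)
  have "(\<Sum>n<L. e n) = 1"
    using c' d' uw by (simp add: e_def sum.distrib flip: sum_distrib_left)
  moreover have "u *\<^sub>R y + w *\<^sub>R z = (\<Sum>n<L. e n *\<^sub>R x n)"
    by (simp add: c' d' e_def scaleR_sum_right sum.distrib scaleR_add_left)
  moreover have "\<forall>n. 0 \<le> e n" "\<forall>n\<ge>L. e n = 0"
    using c d uw by (auto simp: e_def L_def)
  ultimately show "u *\<^sub>R y + w *\<^sub>R z \<in> finite_convex_combinations x"
    unfolding finite_convex_combinations_def by blast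
qed

lemma norm_weighted_sum_le:
  fixes x :: "nat \<Rightarrow> 'b::real_normed_vector"
  assumes "\<And>n. norm (x n) \<le> 1"
  shows "norm (\<Sum>n\<in>A. c n *\<^sub>R x n) \<le> (\<Sum>n\<in>A. \<bar>c n\<bar>)"
proof (rule order_trans[OF norm_sum sum_mono])
  fix n show "norm (c n *\<^sub>R x n) \<le> \<bar>c n\<bar>"
    using mult_left_mono[OF assms[of n], of "\<bar>c n\<bar>"] by simp
qed

lemma finite_convex_combinations_subset_cball:
  fixes x :: "nat \<Rightarrow> 'b::real_normed_vector"
  assumes "\<And>n. norm (x n) \<le> 1"
  shows "finite_convex_combinations x \<subseteq> cball 0 1"
proof
  fix z assume "z \<in> finite_convex_combinations x"
  then obtain c N where c: "\<And>n. 0 \<le> c n" "(\<Sum>n<N. c n) = (1::real)"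
    "z = (\<Sum>n<N. c n *\<^sub>R x n)" using finite_convex_combinationsE by blast
  then show "z \<in> cball 0 1"
    using norm_weighted_sum_le[where x = x and c = c and A = "{..<N}", OF assms] by simp
qed

section \<open>The gliding hump\<close>

text \<open>Some subsequence of the rows \<open>c k\<close> has a pointwise limit \<open>a\<close>,
  of total mass at most 1. Rows and cuts are chosen in turn: before \<open>N j\<close> the row
  \<open>k j\<close> is close to \<open>a\<close>, and it ends by \<open>N (Suc j)\<close>, so the
  remaining parts of the rows lie in disjoint blocks. The limits \<open>p\<close> and
  \<open>s\<close> are the sums of the \<open>a n *\<^sub>R x n\<close> and of the
  \<open>a n\<close>.\<close>

lemma gliding_hump:
  fixes x :: "nat \<Rightarrow> 'b::banach" and c :: "nat \<Rightarrow> nat \<Rightarrow> real" and M :: "nat \<Rightarrow> nat"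
  assumes x: "\<And>n. norm (x n) \<le> 1"
    and c: "\<And>k n. 0 \<le> c k n" and supp: "\<And>k n. M k \<le> n \<Longrightarrow> c k n = 0"
    and one: "\<And>k. (\<Sum>n<M k. c k n) = 1"
  obtains N k p s where "strict_mono (N::nat \<Rightarrow> nat)" "\<And>j. j \<le> k j" "\<And>j. M (k j) \<le> N (Suc j)"
    "(\<lambda>j. \<Sum>n<N j. c (k j) n *\<^sub>R x n) \<longlonglongrightarrow> p" "(\<lambda>j. \<Sum>n<N j. c (k j) n) \<longlonglongrightarrow> s"
proof -
  have sum_le: "(\<Sum>n\<in>A. c k n) \<le> 1" if "finite A" for A k
  proof -
    have "(\<Sum>n\<in>A. c k n) = (\<Sum>n\<in>A \<inter> {..<M k}. c k n)"
      using that supp by (intro sum.mono_neutral_right) (auto simp: not_less)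
    also have "\<dots> \<le> (\<Sum>n<M k. c k n)" using c by (intro sum_mono2) auto
    finally show ?thesis using one by simp
  qed
  have "\<bar>c k n\<bar> \<le> 1" for k n using sum_le[of "{n}" k] c[of k n] by simp
  then obtain r a where r: "strict_mono (r::nat \<Rightarrow> nat)" and a: "\<And>i. (\<lambda>n. c (r n) i) \<longlonglongrightarrow> a i"
    using pointwise_convergent_subsequence[of c "\<lambda>_. 1"] by blast
  have a0: "0 \<le> a i" for i by (rule LIMSEQ_le_const[OF a]) (use c in auto)
  have "(\<Sum>i<n. a i) \<le> 1" for n
    by (rule LIMSEQ_le_const2[OF tendsto_sum[OF a]]) (use sum_le in auto)
  then have "summable a" using a0 by (intro summableI_nonneg_bounded) auto
  have "summable (\<lambda>n. a n *\<^sub>R x n)"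
  proof (rule summable_comparison_test[OF _ \<open>summable a\<close>], intro exI allI impI)
    fix n show "norm (a n *\<^sub>R x n) \<le> a n"
      using mult_left_mono[OF x[of n] a0[of n]] a0[of n] by simp
  qed
  \<comment> \<open>On a fixed initial segment, pointwise convergence is convergence in the l1 norm.
    The witness is a row \<open>r m\<close> with \<open>m \<ge> j\<close>.\<close>
  have "\<exists>k\<ge>j. (\<Sum>n<N. \<bar>c k n - a n\<bar>) < inverse (Suc j)" for N j
  proof -
    have "(\<lambda>m. \<Sum>n<N. \<bar>c (r m) n - a n\<bar>) \<longlonglongrightarrow> (\<Sum>n<N. \<bar>a n - a n\<bar>)"
      by (intro tendsto_intros a)
    then have "eventually (\<lambda>m. (\<Sum>n<N. \<bar>c (r m) n - a n\<bar>) < inverse (Suc j)) sequentially"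
      by (auto dest!: order_tendstoD(2)[of _ _ _ "inverse (Suc j)"])
    then have "eventually (\<lambda>m. (\<Sum>n<N. \<bar>c (r m) n - a n\<bar>) < inverse (Suc j) \<and> m \<ge> j) sequentially"
      by (intro eventually_conj eventually_ge_at_top)
    then obtain m where "m \<ge> j" "(\<Sum>n<N. \<bar>c (r m) n - a n\<bar>) < inverse (Suc j)"
      using eventually_happens'[OF sequentially_bot] by blast
    moreover have "r m \<ge> m" by (rule seq_suble[OF r])
    ultimately show ?thesis by (intro exI[of _ "r m"]) auto
  qed
  then have "\<forall>N. \<forall>j. \<exists>k. j \<le> k \<and> (\<Sum>n<N. \<bar>c k n - a n\<bar>) < inverse (Suc j)" by blast
  then have "\<exists>\<kappa>. \<forall>N j. j \<le> \<kappa> N j \<and> (\<Sum>n<N. \<bar>c (\<kappa> N j) n - a n\<bar>) < inverse (Suc j)"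
    by (simp only: choice_iff)
  then obtain \<kappa> where \<kappa>: "\<And>N j. j \<le> \<kappa> N j"
      "\<And>N j. (\<Sum>n<N. \<bar>c (\<kappa> N j) n - a n\<bar>) < inverse (Suc j)"
    by blast
  \<comment> \<open>The next cut lies past the support of the row chosen for the present one;
    \<open>Suc\<close> makes the cuts strictly increasing.\<close>
  define N where "N = rec_nat 0 (\<lambda>j m. Suc (m + M (\<kappa> m j)))"
  have N: "N (Suc j) = Suc (N j + M (\<kappa> (N j) j))" for j by (simp add: N_def)
  define k where "k j = \<kappa> (N j) j" for j
  have sN: "strict_mono N" by (auto simp: strict_mono_Suc_iff N)
  \<comment> \<open>This l1 bound controls the vectors, since \<open>norm (x n) \<le> 1\<close>, as
    well as the masses, so the heads of the rows inherit the limits of the partial sums for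
    \<open>a\<close>.\<close>
  have small: "(\<lambda>j. \<Sum>n<N j. \<bar>c (k j) n - a n\<bar>) \<longlonglongrightarrow> 0"
  proof (rule tendsto_sandwich[OF _ _ tendsto_const LIMSEQ_inverse_real_of_nat])
    show "eventually (\<lambda>j. 0 \<le> (\<Sum>n<N j. \<bar>c (k j) n - a n\<bar>)) sequentially"
      by (intro always_eventually allI sum_nonneg) auto
    show "eventually (\<lambda>j. (\<Sum>n<N j. \<bar>c (k j) n - a n\<bar>) \<le> inverse (Suc j)) sequentially"
      using \<kappa>(2) by (intro always_eventually allI) (auto simp: k_def intro: less_imp_le)
  qed
  have "(\<lambda>j. \<Sum>n<N j. (c (k j) n - a n) *\<^sub>R x n) \<longlonglongrightarrow> 0"
    using norm_weighted_sum_le[OF x] by (intro Lim_null_comparison[OF _ small]) auto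
  moreover have "(\<lambda>j. \<Sum>n<N j. a n *\<^sub>R x n) \<longlonglongrightarrow> (\<Sum>n. a n *\<^sub>R x n)"
    using LIMSEQ_subseq_LIMSEQ[OF summable_LIMSEQ[OF \<open>summable (\<lambda>n. a n *\<^sub>R x n)\<close>] sN]
    by (simp add: o_def)
  ultimately have "(\<lambda>j. (\<Sum>n<N j. (c (k j) n - a n) *\<^sub>R x n) + (\<Sum>n<N j. a n *\<^sub>R x n))
      \<longlonglongrightarrow> 0 + (\<Sum>n. a n *\<^sub>R x n)"
    by (rule tendsto_add)
  then have p: "(\<lambda>j. \<Sum>n<N j. c (k j) n *\<^sub>R x n) \<longlonglongrightarrow> (\<Sum>n. a n *\<^sub>R x n)"
    by (simp add: scaleR_left_diff_distrib flip: sum.distrib)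
  have "(\<lambda>j. \<Sum>n<N j. c (k j) n - a n) \<longlonglongrightarrow> 0"
    by (intro Lim_null_comparison[OF _ small] always_eventually) auto
  moreover have "(\<lambda>j. \<Sum>n<N j. a n) \<longlonglongrightarrow> (\<Sum>n. a n)"
    using LIMSEQ_subseq_LIMSEQ[OF summable_LIMSEQ[OF \<open>summable a\<close>] sN]
    by (simp add: o_def)
  ultimately have "(\<lambda>j. (\<Sum>n<N j. c (k j) n - a n) + (\<Sum>n<N j. a n)) \<longlonglongrightarrow> 0 + (\<Sum>n. a n)"
    by (rule tendsto_add)
  then have s: "(\<lambda>j. \<Sum>n<N j. c (k j) n) \<longlonglongrightarrow> (\<Sum>n. a n)"
    by (simp flip: sum.distrib)
  show thesis
    by (rule that[OF sN _ _ p s]) (use \<kappa> in \<open>auto simp: k_def N\<close>)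
qed

section \<open>Weak*-sequential closedness of the norm closed hull\<close>

text \<open>Each \<open>z (k j)\<close> splits into a head that converges in norm to
  \<open>p\<close> and a tail \<open>q j\<close> whose mass \<open>m j\<close> tends to
  \<open>1 - s\<close>. Either the tails vanish in norm and \<open>f = p\<close>, or the normalised
  tails form a weak* convergent convex block subsequence, against \<open>no_cbs\<close>.\<close>

lemma weak_star_limit_in_closure:
  fixes x :: "nat \<Rightarrow> ('a::banach) dual"
  assumes x: "\<And>n. norm (x n) \<le> 1"
    and no_cbs: "\<And>y g. convex_block_subsequence y x \<Longrightarrow> \<not> limitin weak_star_topology y g sequentially"
    and z: "\<And>k. z k \<in> finite_convex_combinations x"
    and lim: "limitin weak_star_topology z f sequentially"
  shows "f \<in> closure (finite_convex_combinations x)"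
proof -
  have "\<exists>c M. (\<forall>n. 0 \<le> c n) \<and> (\<forall>n\<ge>M. c n = 0) \<and> (\<Sum>n<M. c n) = (1::real) \<and>
    z k = (\<Sum>n<M. c n *\<^sub>R x n)" for k
    using z[of k] unfolding finite_convex_combinations_def by blast
  then obtain c M where c: "\<And>k n. 0 \<le> c k n" "\<And>k n. M k \<le> n \<Longrightarrow> c k n = 0"
      "\<And>k. (\<Sum>n<M k. c k n) = 1" "\<And>k. z k = (\<Sum>n<M k. c k n *\<^sub>R x n)"
    by metis
  obtain N k p s where N: "strict_mono (N::nat \<Rightarrow> nat)" and k: "\<And>j. j \<le> k j"
    and MN: "\<And>j. M (k j) \<le> N (Suc j)"
    and p: "(\<lambda>j. \<Sum>n<N j. c (k j) n *\<^sub>R x n) \<longlonglongrightarrow> p" and s: "(\<lambda>j. \<Sum>n<N j. c (k j) n) \<longlonglongrightarrow> s"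
    using gliding_hump[of x c M, OF x c(1-3)] by blast
  define q where "q j = (\<Sum>n=N j..<N (Suc j). c (k j) n *\<^sub>R x n)" for j
  define m where "m j = (\<Sum>n=N j..<N (Suc j). c (k j) n)" for j
  have split: "(\<Sum>n<N (Suc j). g n) = (\<Sum>n<N j. g n) + (\<Sum>n=N j..<N (Suc j). g n)"
    for j and g :: "nat \<Rightarrow> 'c::comm_monoid_add"
    using N sum.atLeastLessThan_concat[of 0 "N j" "N (Suc j)" g]
    by (simp add: lessThan_atLeast0 strict_mono_less_eq)
  \<comment> \<open>Row \<open>k j\<close> ends by \<open>N (Suc j)\<close>, so the sum up to there
    is all of \<open>z (k j)\<close>.\<close>
  have zk: "z (k j) = (\<Sum>n<N j. c (k j) n *\<^sub>R x n) + q j" for j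
    unfolding q_def split[symmetric] c(4)
    by (rule sum_lessThan_eq_of_support[symmetric]) (use MN c(2) in auto)
  have mk: "1 = (\<Sum>n<N j. c (k j) n) + m j" for j
    unfolding m_def split[symmetric] c(3)[of "k j", symmetric]
    by (rule sum_lessThan_eq_of_support[symmetric]) (use MN c(2) in auto)
  have m0: "0 \<le> m j" for j unfolding m_def using c by (intro sum_nonneg) auto
  have "m j = 1 - (\<Sum>n<N j. c (k j) n)" for j using mk[of j] by simp
  then have m: "m \<longlonglongrightarrow> 1 - s" using tendsto_diff[OF tendsto_const s, of 1] by presburger
  have "filterlim k sequentially sequentially"
    using k by (intro filterlim_at_top_mono[OF filterlim_ident]) auto
  then have limk: "(\<lambda>j. blinfun_apply (z (k j)) v) \<longlonglongrightarrow> blinfun_apply f v" for v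
    using lim filterlim_compose unfolding limitin_weak_star_iff by blast
  show ?thesis
  proof (cases "s = 1")
    case True
    have "norm (q j) \<le> m j" for j
      using norm_weighted_sum_le[of x "c (k j)" "{N j..<N (Suc j)}", OF x] c(1)
      by (simp add: q_def m_def)
    then have "q \<longlonglongrightarrow> 0"
      using m True by (intro Lim_null_comparison[of q m]) auto
    then have zp: "(\<lambda>j. z (k j)) \<longlonglongrightarrow> p"
      unfolding zk using tendsto_add[OF p] by fastforce
    have "blinfun_apply p v = blinfun_apply f v" for v
      using tendsto_imp_limitin_weak_star[OF zp] limk LIMSEQ_unique
      unfolding limitin_weak_star_iff by blast
    then have "p = f" by (rule blinfun_eqI)
    then show ?thesis using zp z unfolding closure_sequential by metis
  next
    case False
    have "0 \<le> 1 - s" by (rule LIMSEQ_le_const[OF m]) (use m0 in auto)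
    with False have s1: "0 < 1 - s" by simp
    with m have "eventually (\<lambda>j. 0 < m j) sequentially" by (rule order_tendstoD)
    \<comment> \<open>Early tails may have mass zero; the shift by \<open>j0\<close> drops them
      before the division by \<open>m\<close>.\<close>
    then obtain j0 where j0: "\<And>j. j \<ge> j0 \<Longrightarrow> 0 < m j" by (auto simp: eventually_sequentially)
    define y where "y i = inverse (m (i + j0)) *\<^sub>R q (i + j0)" for i
    have "convex_block_subsequence y x"
    proof (rule convex_block_subsequenceI[of "\<lambda>i. N (i + j0)"
          "\<lambda>i n. inverse (m (i + j0)) * c (k (i + j0)) n"])
      show "strict_mono (\<lambda>i. N (i + j0))" using N by (auto simp: strict_mono_Suc_iff)
      show "(\<Sum>n = N (i + j0)..<N (Suc i + j0). inverse (m (i + j0)) * c (k (i + j0)) n) = 1" for i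
        using j0[of "i + j0"] by (simp add: m_def flip: sum_distrib_left)
    qed (use c m0 in \<open>auto simp: y_def q_def scaleR_sum_right\<close>)
    \<comment> \<open>The tail \<open>q j\<close> is \<open>z (k j)\<close> minus its head, hence
      tends weak* to \<open>f - p\<close>, while its mass tends to \<open>1 - s\<close>.\<close>
    moreover have "limitin weak_star_topology y (inverse (1 - s) *\<^sub>R (f - p)) sequentially"
      unfolding limitin_weak_star_iff
    proof
      fix v
      have "blinfun_apply (q j) v
          = blinfun_apply (z (k j)) v - blinfun_apply (\<Sum>n<N j. c (k j) n *\<^sub>R x n) v" for j
        by (simp add: zk blinfun.add_left)
      moreover have "(\<lambda>j. blinfun_apply (z (k j)) v - blinfun_apply (\<Sum>n<N j. c (k j) n *\<^sub>R x n) v)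
          \<longlonglongrightarrow> blinfun_apply f v - blinfun_apply p v"
        using limk tendsto_imp_limitin_weak_star[OF p]
        unfolding limitin_weak_star_iff by (intro tendsto_diff) auto
      ultimately have "(\<lambda>j. blinfun_apply (q j) v) \<longlonglongrightarrow> blinfun_apply f v - blinfun_apply p v"
        by simp
      then have "(\<lambda>j. inverse (m j) * blinfun_apply (q j) v)
          \<longlonglongrightarrow> inverse (1 - s) * (blinfun_apply f v - blinfun_apply p v)"
        using m s1 by (intro tendsto_intros) auto
      from LIMSEQ_ignore_initial_segment[OF this, of j0]
      show "(\<lambda>i. blinfun_apply (y i) v) \<longlonglongrightarrow> blinfun_apply (inverse (1 - s) *\<^sub>R (f - p)) v"
        by (simp add: y_def blinfun.scaleR_left blinfun.diff_left)
    qed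
    ultimately show ?thesis using no_cbs by blast
  qed
qed

text \<open>A sequence in the closure differs by a norm null sequence from one of finite
  combinations, which has the same weak* limit, so \<open>weak_star_limit_in_closure\<close>
  applies.\<close>

lemma weak_star_seq_closed_closure_combinations:
  fixes x :: "nat \<Rightarrow> ('a::banach) dual"
  assumes x: "\<And>n. norm (x n) \<le> 1"
    and no_cbs: "\<And>y g. convex_block_subsequence y x \<Longrightarrow> \<not> limitin weak_star_topology y g sequentially"
  shows "weak_star_seq_closed (closure (finite_convex_combinations x))"
proof -
  let ?S = "finite_convex_combinations x"
  have "f \<in> closure ?S"
    if s: "\<And>n. s n \<in> closure ?S" and lim: "limitin weak_star_topology s f sequentially" for s f
  proof -
    have "\<exists>w\<in>?S. dist w (s n) < inverse (Suc n)" for n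
      using s[of n] unfolding closure_approachable by simp
    then obtain w where w: "\<And>n. w n \<in> ?S" "\<And>n. dist (w n) (s n) < inverse (Suc n)" by metis
    have "(\<lambda>n. w n - s n) \<longlonglongrightarrow> 0"
      using w(2) by (intro Lim_null_comparison[OF _ LIMSEQ_inverse_real_of_nat] always_eventually)
        (metis dist_norm less_imp_le)
    have "limitin weak_star_topology w f sequentially"
      unfolding limitin_weak_star_iff
    proof
      fix v
      have "(\<lambda>n. blinfun_apply (w n - s n) v) \<longlonglongrightarrow> 0"
        using tendsto_imp_limitin_weak_star[OF \<open>(\<lambda>n. w n - s n) \<longlonglongrightarrow> 0\<close>]
        unfolding limitin_weak_star_iff by simp
      moreover have "(\<lambda>n. blinfun_apply (s n) v) \<longlonglongrightarrow> blinfun_apply f v"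
        using lim unfolding limitin_weak_star_iff by blast
      ultimately have "(\<lambda>n. blinfun_apply (w n - s n) v + blinfun_apply (s n) v)
          \<longlonglongrightarrow> 0 + blinfun_apply f v"
        by (rule tendsto_add)
      then show "(\<lambda>n. blinfun_apply (w n) v) \<longlonglongrightarrow> blinfun_apply f v"
        by (simp add: blinfun.diff_left)
    qed
    then show ?thesis using weak_star_limit_in_closure[of x w f, OF x no_cbs w(1)] by blast
  qed
  \<comment> \<open>Constant sequences give the other inclusion.\<close>
  moreover have "\<exists>s. (\<forall>n::nat. s n \<in> closure ?S) \<and> limitin weak_star_topology s f sequentially"
    if "f \<in> closure ?S" for f
    using that by (intro exI[of _ "\<lambda>_. f"]) (simp add: strong_operator_topology_topspace)
  ultimately show ?thesis unfolding weak_star_seq_closed_def by blast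
qed

section \<open>Separability\<close>

text \<open>Lists of rationals form a countable type, so countably many combinations approximate all
  differences. Differences are what matters because separating \<open>p\<close> from
  \<open>q\<close> means detecting \<open>p - q\<close>.\<close>

lemma rational_combination_near_difference:
  fixes x :: "nat \<Rightarrow> 'b::real_normed_vector"
  assumes x: "\<And>n. norm (x n) \<le> 1"
    and p: "p \<in> closure (finite_convex_combinations x)"
    and q: "q \<in> closure (finite_convex_combinations x)" and e: "0 < e"
  obtains l :: "rat list" where
    "norm (p - q - (\<Sum>n<length l. real_of_rat (l ! n) *\<^sub>R x n)) < e"
proof -
  obtain y z where y: "y \<in> finite_convex_combinations x" "norm (y - p) < e / 3"
    and z: "z \<in> finite_convex_combinations x" "norm (z - q) < e / 3"
    using p[unfolded closure_approachable dist_norm, rule_format, of "e / 3"]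
      q[unfolded closure_approachable dist_norm, rule_format, of "e / 3"] e by auto
  obtain c N where c: "\<And>n. N \<le> n \<Longrightarrow> c n = 0" "y = (\<Sum>n<N. c n *\<^sub>R x n)"
    using y(1) finite_convex_combinationsE by blast
  obtain d M where d: "\<And>n. M \<le> n \<Longrightarrow> d n = 0" "z = (\<Sum>n<M. d n *\<^sub>R x n)"
    using z(1) finite_convex_combinationsE by blast
  \<comment> \<open>\<open>Suc\<close> keeps \<open>L\<close> positive, so that
    \<open>e / (3 * L)\<close> is a positive tolerance for each coefficient; the \<open>L\<close>
    errors add up to at most \<open>e / 3\<close>.\<close>
  define L where "L = Suc (max N M)"
  have yz: "y - z = (\<Sum>n<L. (c n - d n) *\<^sub>R x n)"
    using c d sum_lessThan_eq_of_support[of N L "\<lambda>n. c n *\<^sub>R x n"]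
      sum_lessThan_eq_of_support[of M L "\<lambda>n. d n *\<^sub>R x n"]
    by (simp add: L_def scaleR_left_diff_distrib sum_subtractf)
  have "\<exists>r. \<bar>c n - d n - real_of_rat r\<bar> < e / (3 * L)" for n
  proof -
    have "c n - d n - e / (3 * L) < c n - d n + e / (3 * L)" using e by (simp add: L_def)
    from of_rat_dense[OF this] obtain q where
      "c n - d n - e / (3 * L) < real_of_rat q" "real_of_rat q < c n - d n + e / (3 * L)" by blast
    then show ?thesis by (intro exI[of _ q]) (simp add: abs_less_iff)
  qed
  then obtain r where r: "\<And>n. \<bar>c n - d n - real_of_rat (r n)\<bar> < e / (3 * L)" by metis
  define l where "l = map r [0..<L]"
  have l: "(\<Sum>n<length l. real_of_rat (l ! n) *\<^sub>R x n) = (\<Sum>n<L. real_of_rat (r n) *\<^sub>R x n)"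
    by (simp add: l_def)
  have "norm (y - z - (\<Sum>n<L. real_of_rat (r n) *\<^sub>R x n))
      = norm (\<Sum>n<L. (c n - d n - real_of_rat (r n)) *\<^sub>R x n)"
    by (simp add: yz scaleR_left_diff_distrib sum_subtractf)
  also have "\<dots> \<le> (\<Sum>n<L. \<bar>c n - d n - real_of_rat (r n)\<bar>)" by (rule norm_weighted_sum_le[OF x])
  also have "\<dots> \<le> (\<Sum>n<L. e / (3 * L))" using r by (intro sum_mono) (auto intro: less_imp_le)
  also have "\<dots> = e / 3" using L_def by (simp add: field_simps)
  finally have "norm (y - z - (\<Sum>n<L. real_of_rat (r n) *\<^sub>R x n)) \<le> e / 3" .
  moreover have "norm (p - q - w) \<le> norm (y - z - w) + norm (y - p) + norm (z - q)" for w
  proof -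
    have eq: "p - q - w = (y - z - w) - (y - p) + (z - q)" by simp
    show ?thesis
      using norm_triangle_ineq[of "(y - z - w) - (y - p)" "z - q"]
        norm_triangle_ineq4[of "y - z - w" "y - p"] unfolding eq by linarith
  qed
  note this[of "\<Sum>n<L. real_of_rat (r n) *\<^sub>R x n"]
  ultimately show thesis using y(2) z(2) by (intro that[of l]) (simp add: l)
qed

text \<open>Otherwise \<open>norm f / 2\<close> would bound \<open>f\<close> on the unit ball and
  hence, by scaling, its operator norm. The factor 2 leaves room because the norm may not be
  attained.\<close>

lemma norm_attained_up_to_half:
  fixes f :: "'a::real_normed_vector \<Rightarrow>\<^sub>L real"
  obtains v where "norm v \<le> 1" "norm f \<le> 2 * \<bar>blinfun_apply f v\<bar>"
proof -
  have "\<exists>v. norm v \<le> 1 \<and> norm f \<le> 2 * \<bar>blinfun_apply f v\<bar>"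
  proof (rule ccontr)
    assume "\<not> ?thesis"
    then have *: "2 * \<bar>blinfun_apply f v\<bar> < norm f" if "norm v \<le> 1" for v
      using that by (meson not_le)
    have "norm f \<le> norm f / 2"
    proof (rule norm_blinfun_bound)
      fix v
      show "norm (blinfun_apply f v) \<le> norm f / 2 * norm v"
      proof (cases "v = 0")
        case False
        have "2 * \<bar>blinfun_apply f (inverse (norm v) *\<^sub>R v)\<bar> < norm f" using False by (intro *) simp
        then show ?thesis using False by (simp add: blinfun.scaleR_right abs_mult field_simps)
      qed simp
    qed simp
    moreover have "0 < norm f" using *[of 0] by simp
    ultimately show False by simp
  qed
  with that show thesis by blast
qed

text \<open>Each rational combination \<open>t l\<close> gets a vector that norms it up to a factor
  2. If \<open>p\<close> and \<open>q\<close> agree on all these vectors and \<open>t l\<close> is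
  close to \<open>p - q\<close>, then \<open>t l\<close> is small at its own vector, hence small in
  norm, and so is \<open>p - q\<close>.\<close>

lemma countable_separating_vectors:
  fixes x :: "nat \<Rightarrow> 'a::real_normed_vector \<Rightarrow>\<^sub>L real"
  assumes x: "\<And>n. norm (x n) \<le> 1"
  shows "\<exists>d :: nat \<Rightarrow> 'a. \<forall>p \<in> closure (finite_convex_combinations x).
    \<forall>q \<in> closure (finite_convex_combinations x).
      (\<forall>i. blinfun_apply p (d i) = blinfun_apply q (d i)) \<longrightarrow> p = q"
proof -
  define t where "t l = (\<Sum>n<length l. real_of_rat (l ! n) *\<^sub>R x n)" for l :: "rat list"
  have "\<exists>v. norm v \<le> 1 \<and> norm (t l) \<le> 2 * \<bar>blinfun_apply (t l) v\<bar>" for l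
    using norm_attained_up_to_half by metis
  then obtain v where v: "\<And>l. norm (v l) \<le> 1"
      "\<And>l. norm (t l) \<le> 2 * \<bar>blinfun_apply (t l) (v l)\<bar>"
    by metis
  show ?thesis
  \<comment> \<open>\<open>from_nat\<close> enumerates the countable type
    \<open>rat list\<close>.\<close>
  proof (intro exI[of _ "\<lambda>i. v (from_nat i)"] ballI impI)
    fix p q
    assume pq: "p \<in> closure (finite_convex_combinations x)" "q \<in> closure (finite_convex_combinations x)"
      and eq: "\<forall>i. blinfun_apply p (v (from_nat i)) = blinfun_apply q (v (from_nat i))"
    have "norm (p - q) \<le> 0 + e" if e: "0 < e" for e
    proof -
      obtain l where l: "norm (p - q - t l) < e / 3"
        using rational_combination_near_difference[OF x pq, of "e / 3"] e unfolding t_def by auto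
      have "blinfun_apply (p - q) (v l) = 0"
        using eq[rule_format, of "to_nat l"] by (simp add: blinfun.diff_left)
      then have "\<bar>blinfun_apply (t l) (v l)\<bar> = norm (blinfun_apply (p - q - t l) (v l))"
        by (simp add: blinfun.diff_left)
      also have "\<dots> \<le> norm (p - q - t l)"
        using norm_blinfun[of "p - q - t l" "v l"] mult_left_mono[OF v(1)[of l], of "norm (p - q - t l)"]
        by simp
      \<comment> \<open>The norm of \<open>t l\<close> costs twice the approximation error
        \<open>e / 3\<close>, which leaves one third for \<open>p - q - t l\<close>.\<close>
      finally have "norm (t l) < 2 * (e / 3)" using v(2)[of l] l by linarith
      moreover have "norm (p - q) \<le> norm (p - q - t l) + norm (t l)"
        using norm_triangle_ineq[of "p - q - t l" "t l"] by simp
      ultimately show ?thesis using l by simp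
    qed
    then have "norm (p - q) \<le> 0" by (rule field_le_epsilon)
    then show "p = q" by simp
  qed
qed

section \<open>Weak* convergent subsequences and the conclusion\<close>

text \<open>Closedness keeps all weak* cluster points in the norm closed hull, where the values at
  the \<open>d i\<close> determine a point. A subsequence that converges at every \<open>d i\<close>
  thus has a single cluster point, and boundedness makes it the limit.\<close>

lemma weak_star_closed_imp_convergent_subsequence:
  fixes x :: "nat \<Rightarrow> ('a::banach) dual"
  assumes x: "\<And>n. norm (x n) \<le> 1"
    and closed: "closedin weak_star_topology (closure (finite_convex_combinations x))"
  obtains r p where "strict_mono (r::nat \<Rightarrow> nat)" "limitin weak_star_topology (x \<circ> r) p sequentially"
proof -
  let ?C = "closure (finite_convex_combinations x)"
  obtain d :: "nat \<Rightarrow> 'a" where d: "\<forall>p\<in>?C. \<forall>q\<in>?C.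
      (\<forall>i. blinfun_apply p (d i) = blinfun_apply q (d i)) \<longrightarrow> p = q"
    using countable_separating_vectors[of x, OF x] by (rule exE)
  have bd: "\<bar>blinfun_apply (x n) (d i)\<bar> \<le> norm (d i)" for n i
    using norm_blinfun[of "x n" "d i"] mult_right_mono[OF x[of n], of "norm (d i)"]
    by simp
  then obtain r l where r: "strict_mono (r::nat \<Rightarrow> nat)"
    and l: "\<And>i. (\<lambda>n. blinfun_apply (x (r n)) (d i)) \<longlonglongrightarrow> l i"
    using pointwise_convergent_subsequence[of "\<lambda>n i. blinfun_apply (x n) (d i)", OF bd] by blast
  \<comment> \<open>Stated for all proper filters finer than \<open>sequentially\<close>:
    \<open>sequentially\<close> itself yields the candidate limit, and a filter on bad indices will
    yield the contradiction.\<close>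
  have cluster: "\<exists>G p. G \<le> F \<and> G \<noteq> bot \<and> limitin weak_star_topology (x \<circ> r) p G \<and>
      p \<in> ?C \<and> (\<forall>i. blinfun_apply p (d i) = l i)" if F: "F \<le> sequentially" "F \<noteq> bot" for F
  proof -
    obtain G p where G: "G \<le> F" "G \<noteq> bot" "limitin weak_star_topology (x \<circ> r) p G"
      using bounded_imp_weak_star_cluster_point[of F "x \<circ> r" 1] F x by auto
    have "eventually (\<lambda>n. (x \<circ> r) n \<in> ?C) G"
      using element_in_finite_convex_combinations closure_subset by (intro always_eventually) force
    then have "p \<in> ?C" using limitin_closedin[OF G(3) closed _ G(2)] by blast
    moreover have "blinfun_apply p (d i) = l i" for i
    proof (rule tendsto_unique[OF G(2)])
      show "((\<lambda>n. blinfun_apply (x (r n)) (d i)) \<longlongrightarrow> blinfun_apply p (d i)) G"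
        using G(3) by (simp add: limitin_weak_star_iff)
      show "((\<lambda>n. blinfun_apply (x (r n)) (d i)) \<longlongrightarrow> l i) G"
        using l tendsto_mono G(1) F(1) order_trans by metis
    qed
    ultimately show ?thesis using G by blast
  qed
  obtain p where p: "p \<in> ?C" "\<And>i. blinfun_apply p (d i) = l i"
    using cluster[of sequentially] by auto
  have "(\<lambda>n. blinfun_apply (x (r n)) v) \<longlonglongrightarrow> blinfun_apply p v" for v
  proof (rule tendstoI, rule ccontr)
    fix e :: real
    assume e: "0 < e" and
      "\<not> eventually (\<lambda>n. dist (blinfun_apply (x (r n)) v) (blinfun_apply p v) < e) sequentially"
    \<comment> \<open>If convergence fails at \<open>v\<close>, errors of at least \<open>e\<close>
      occur infinitely often. Restricting to these indices leaves a proper filter, whose cluster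
      point must again be \<open>p\<close>.\<close>
    define A where "A = {n. e \<le> dist (blinfun_apply (x (r n)) v) (blinfun_apply p v)}"
    define F where "F = inf sequentially (principal A)"
    have "F \<noteq> bot"
      using \<open>\<not> eventually _ _\<close>
      unfolding F_def trivial_limit_def eventually_inf_principal A_def by (simp add: not_le)
    then obtain G q where G: "G \<le> F" "G \<noteq> bot" "limitin weak_star_topology (x \<circ> r) q G"
        "q \<in> ?C" "\<And>i. blinfun_apply q (d i) = l i"
      using cluster[of F] by (auto simp: F_def)
    have "q = p" using d[rule_format, OF G(4) p(1)] G(5) p(2) by simp
    then have "((\<lambda>n. blinfun_apply (x (r n)) v) \<longlongrightarrow> blinfun_apply p v) G"
      using G(3) by (simp add: limitin_weak_star_iff)
    then have "eventually (\<lambda>n. dist (blinfun_apply (x (r n)) v) (blinfun_apply p v) < e) G"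
      using e by (rule tendstoD)
    moreover have "eventually (\<lambda>n. n \<in> A) G"
      using G(1) by (rule filter_leD) (simp add: F_def eventually_inf_principal)
    ultimately have "eventually (\<lambda>n. False) G" by eventually_elim (simp add: A_def)
    with G(2) show False by simp
  qed
  then have "limitin weak_star_topology (x \<circ> r) p sequentially" by (simp add: limitin_weak_star_iff)
  with r show thesis using that by blast
qed

lemma property_E'_imp_convergent_block_in_ball:
  fixes x :: "nat \<Rightarrow> ('a::banach) dual"
  assumes E': "property_E' TYPE('a)" and x: "\<And>n. norm (x n) \<le> 1"
  obtains y f where "convex_block_subsequence y x" "limitin weak_star_topology y f sequentially"
proof (rule ccontr)
  assume "\<not> thesis"
  with that have no_cbs:
    "\<And>y f. convex_block_subsequence y x \<Longrightarrow> \<not> limitin weak_star_topology y f sequentially"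
    by blast
  let ?C = "closure (finite_convex_combinations x)"
  have "?C \<subseteq> cball 0 1"
    using finite_convex_combinations_subset_cball[of x, OF x] by (simp add: closure_minimal)
  moreover have "convex ?C" by (intro convex_closure convex_finite_convex_combinations)
  moreover have "weak_star_seq_closed ?C"
    using weak_star_seq_closed_closure_combinations[of x, OF x no_cbs] by blast
  ultimately have "closedin weak_star_topology ?C"
    using E' unfolding property_E'_def by blast
  then obtain r p where "strict_mono (r::nat \<Rightarrow> nat)"
      "limitin weak_star_topology (x \<circ> r) p sequentially"
    using weak_star_closed_imp_convergent_subsequence[of x, OF x] by blast
  then show False using no_cbs subsequence_imp_convex_block_subsequence by blast
qed

theorem theorem3:
  assumes "property_E' TYPE('a::banach)"
  shows "weak_star_convex_block_compact_dual_ball TYPE('a)"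
  unfolding weak_star_convex_block_compact_dual_ball_def
proof (intro allI impI)
  fix x :: "nat \<Rightarrow> 'a dual"
  assume "bounded (range x)"
  then obtain B where B: "0 < B" "\<And>n. norm (x n) \<le> B" unfolding bounded_pos by auto
  \<comment> \<open>The property speaks of subsets of the unit ball, so the sequence is scaled into
    it; scaling back by \<open>B\<close> keeps blocks and weights.\<close>
  have "norm (inverse B *\<^sub>R x n) \<le> 1" for n using B by (simp add: field_simps)
  then obtain y f where y: "convex_block_subsequence y (\<lambda>n. inverse B *\<^sub>R x n)"
      and f: "limitin weak_star_topology y f sequentially"
    using property_E'_imp_convergent_block_in_ball[OF assms, of "\<lambda>n. inverse B *\<^sub>R x n"] by blast
  have "convex_block_subsequence (\<lambda>k. B *\<^sub>R y k) x"
    using convex_block_subsequence_scaleR[OF y, of B] B(1) by simp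
  moreover have "limitin weak_star_topology (\<lambda>k. B *\<^sub>R y k) (B *\<^sub>R f) sequentially"
    using f by (simp add: limitin_weak_star_iff blinfun.scaleR_left tendsto_mult_left)
  ultimately show "\<exists>y f. convex_block_subsequence y x \<and> limitin weak_star_topology y f sequentially"
    by blast
qed

end
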